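(* Let $n,k\ge 1$, let $M\in\mathbb{R}^{n\times n}$ and a nonzero $H\in\mathbb{R}^{k\times k}$ be fixed, and for each smooth function $f:\mathbb{R}^k\to\mathbb{R}^k$ consider the system of ODEs on $(\mathbb{R}^k)^n$ $$\dot x_i=f(x_i)+H\sum_{j=1}^n M_{i,j}x_j,\qquad i=1,\ldots,n. \quad (\ast)$$ Let $W$ be a linear subspace of $(\mathbb{R}^k)^n$. \begin{enumerate} \item $W$ is dynamically invariant for $(\ast)$ for all odd $f$ if and only if $W=\mathbb{R}^k\otimes\Delta_{\mathcal{P}}$ for some $M$-invariant polydiagonal subspace $\Delta_{\mathcal{P}}$ of $\mathbb{R}^n$. \item $W$ is dynamically invariant for $(\ast)$ for all $f$ that satisfy $f(0)=0$ if and only if $W=\mathbb{R}^k\otimes\Delta_{\mathcal{P}}$ for some $M$-invariant polydiagonal subspace $\Delta_{\mathcal{P}}$ of $\mathbb{R}^n$ that is a synchrony subspace or a minimally tagged anti-synchrony subspace. \item $W$ is dynamically invariant for $(\ast)$ for all $f$ if and only if $W=\mathbb{R}^k\otimes\Delta_{\mathcal{P}}$ for some $M$-invariant synchrony subspace $\Delta_{\mathcal{P}}$ of $\mathbb{R}^n$. \end{enumerate}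
   Context: A linear subspace $W\subseteq(\mathbb{R}^k)^n$ is dynamically invariant for the system if the solution with any initial condition in $W$ stays in $W$ on the interval of existence of that solution. A function $f$ is odd if $f(-y)=-f(y)$ for all $y\in\mathbb{R}^k$. A subspace $V\subseteq\mathbb{R}^n$ is $M$-invariant if $MV\subseteq V$. A partial involution on a set $X$ is a map $x\mapsto x^*:\tilde X\to\tilde X$ defined on a (possibly empty) subset $\tilde X\subseteq X$ that is its own inverse. A tagged partition of a finite set $C$ is a partition $\mathcal{P}$ of $C$ (into nonempty classes) together with a partial involution $P\mapsto P^*$ on $\mathcal{P}$ that has at most one fixed point. The class of $i$ is denoted by $[i]$. For a tagged partition $\mathcal{P}$ of $\{1,\ldots,n\}$, the polydiagonal subspace is $$\Delta_{\mathcal{P}}=\{x\in\mathbb{R}^n\mid x_i=x_j\text{ if }[i]=[j],\text{ and }x_i=-x_j\text{ if }[i]^*=[j]\},$$ and $$\mathbb{R}^k\otimes\Delta_{\mathcal{P}}=\{x\in(\mathbb{R}^k)^n\mid x_i=x_j\text{ if }[i]=[j],\text{ and }x_i=-x_j\text{ if }[i]^*=[j]\}.$$ Distinct tagged partitions give distinct polydiagonal subspaces. $\Delta_{\mathcal{P}}$ is a synchrony subspace if the partial involution is the empty function, an anti-synchrony subspace if it is not the empty function, and minimally tagged if the domain of the partial involution is a singleton set. *)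

theory Defs
  imports "HOL-Analysis.Analysis"
begin

text \<open>
  The spaces \<open>\<real>\<^sup>n\<close> and \<open>(\<real>\<^sup>k)\<^sup>n\<close> are \<^typ>\<open>real ^ 'n\<close> and \<^typ>\<open>real ^ 'k ^ 'n\<close>, where the finite
  type \<^typ>\<open>'n\<close> plays the role of the index set \<open>{1,\<dots>,n}\<close>.
\<close>

text \<open>\<open>C\<^sup>m\<close> on the whole space: all iterated directional derivatives up to order \<open>m\<close> exist as
  Frechet derivatives, and those of order \<open>m\<close> are continuous.\<close>

primrec C_diff :: "nat \<Rightarrow> ('a::euclidean_space \<Rightarrow> 'b::real_normed_vector) \<Rightarrow> bool" where
  "C_diff 0 f \<longleftrightarrow> continuous_on UNIV f"
| "C_diff (Suc m) f \<longleftrightarrow>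
     (\<forall>x. f differentiable (at x)) \<and> (\<forall>v. C_diff m (\<lambda>x. frechet_derivative f (at x) v))"

definition smooth :: "('a::euclidean_space \<Rightarrow> 'b::real_normed_vector) \<Rightarrow> bool" where
  "smooth f \<longleftrightarrow> (\<forall>m. C_diff m f)"

definition odd_fun :: "('a::ab_group_add \<Rightarrow> 'b::ab_group_add) \<Rightarrow> bool" where
  "odd_fun f \<longleftrightarrow> (\<forall>y. f (- y) = - f y)"


text \<open>Solutions of \<open>x' = F(x)\<close> on an open interval around the initial time \<open>0\<close>; the system is
  autonomous, so fixing the initial time loses nothing.\<close>

definition solves_ode :: "('a::real_normed_vector \<Rightarrow> 'a) \<Rightarrow> real set \<Rightarrow> (real \<Rightarrow> 'a) \<Rightarrow> bool" where
  "solves_ode F T x \<longleftrightarrow>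
     open T \<and> is_interval T \<and> 0 \<in> T \<and>
     (\<forall>t\<in>T. (x has_vector_derivative F (x t)) (at t))"

text \<open>The interval \<open>T\<close> is arbitrary, so this covers in particular the maximal interval of existence.\<close>

definition dynamically_invariant :: "('a::real_normed_vector \<Rightarrow> 'a) \<Rightarrow> 'a set \<Rightarrow> bool" where
  "dynamically_invariant F W \<longleftrightarrow>
     (\<forall>T x. solves_ode F T x \<longrightarrow> x 0 \<in> W \<longrightarrow> (\<forall>t\<in>T. x t \<in> W))"

definition network_field ::
  "real^'n^'n \<Rightarrow> real^'k^'k \<Rightarrow> (real^'k \<Rightarrow> real^'k) \<Rightarrow> real^'k^'n \<Rightarrow> real^'k^'n" where
  "network_field M H f x = (\<chi> i. f (x $ i) + H *v (\<Sum>j\<in>UNIV. M $ i $ j *\<^sub>R x $ j))"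

definition matrix_invariant :: "real^'n^'n \<Rightarrow> (real^'n) set \<Rightarrow> bool" where
  "matrix_invariant M V \<longleftrightarrow> (\<lambda>v. M *v v) ` V \<subseteq> V"


text \<open>A partial map is a function into \<^typ>\<open>'a option\<close>. The condition below says both that it
  maps its domain into itself and that it is its own inverse there.\<close>

definition partial_involution_on :: "'a set \<Rightarrow> ('a \<Rightarrow> 'a option) \<Rightarrow> bool" where
  "partial_involution_on X s \<longleftrightarrow>
     dom s \<subseteq> X \<and> (\<forall>x y. s x = Some y \<longrightarrow> s y = Some x)"

definition tagged_partition_on :: "'a set \<Rightarrow> 'a set set \<Rightarrow> ('a set \<Rightarrow> 'a set option) \<Rightarrow> bool" where
  "tagged_partition_on C P s \<longleftrightarrow>
     finite C \<and> partition_on C P \<and> partial_involution_on P s \<and>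
     (\<forall>A B. s A = Some A \<longrightarrow> s B = Some B \<longrightarrow> A = B)"

definition class_of :: "'a set set \<Rightarrow> 'a \<Rightarrow> 'a set" where
  "class_of P i = (THE A. A \<in> P \<and> i \<in> A)"

definition polydiagonal :: "'n set set \<Rightarrow> ('n set \<Rightarrow> 'n set option) \<Rightarrow> (real^'n) set" where
  "polydiagonal P s =
     {x. (\<forall>i j. class_of P i = class_of P j \<longrightarrow> x $ i = x $ j) \<and>
         (\<forall>i j. s (class_of P i) = Some (class_of P j) \<longrightarrow> x $ i = - x $ j)}"

text \<open>\<open>\<real>\<^sup>k \<otimes> \<Delta>\<^sub>P\<close>\<close>

definition tensor_polydiagonal :: "'n set set \<Rightarrow> ('n set \<Rightarrow> 'n set option) \<Rightarrow> (real^'k^'n) set" where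
  "tensor_polydiagonal P s =
     {x. (\<forall>i j. class_of P i = class_of P j \<longrightarrow> x $ i = x $ j) \<and>
         (\<forall>i j. s (class_of P i) = Some (class_of P j) \<longrightarrow> x $ i = - x $ j)}"

text \<open>Distinct tagged partitions have distinct polydiagonal subspaces, so the following properties
  of a polydiagonal subspace are stated for the partial involution of its tagged partition.\<close>

definition synchrony :: "('n set \<Rightarrow> 'n set option) \<Rightarrow> bool" where
  "synchrony s \<longleftrightarrow> s = Map.empty"

definition anti_synchrony :: "('n set \<Rightarrow> 'n set option) \<Rightarrow> bool" where
  "anti_synchrony s \<longleftrightarrow> s \<noteq> Map.empty"

definition minimally_tagged :: "('n set \<Rightarrow> 'n set option) \<Rightarrow> bool" where
  "minimally_tagged s \<longleftrightarrow> is_singleton (dom s)"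

end

theory Submission
  imports Defs
begin

text \<open>
  By Picard-Lindelof and Gronwall, \<open>W\<close> is dynamically invariant iff the vector field maps \<open>W\<close> into
  itself. Taking \<open>f = 0\<close> and subtracting splits this into invariance under the linear part and under
  the pointwise maps \<open>x \<mapsto> (f(x\<^sub>i))\<^sub>i\<close>. A generic \<open>x \<in> W\<close> satisfies only those relations \<open>x\<^sub>i = \<plusminus>x\<^sub>j\<close>
  that hold on all of \<open>W\<close>, so by polynomial interpolation every vector satisfying these relations
  has the form \<open>(f(x\<^sub>i))\<^sub>i\<close> with \<open>f\<close> odd; hence \<open>W\<close> is polydiagonal. Interpolants that vanish at \<open>0\<close> but
  are not odd force \<open>x\<^sub>i = 0\<close> wherever \<open>x\<^sub>i = -x\<^sub>j\<close> holds on \<open>W\<close>, and constant \<open>f\<close> exclude even this.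
  Since \<open>H \<noteq> 0\<close>, some \<open>v\<close> has \<open>Hv \<noteq> 0\<close>, and testing on \<open>v \<otimes> u\<close> recovers the \<open>M\<close>-invariance of the
  polydiagonal subspace.
\<close>

subsection \<open>Subspaces invariant under a flow\<close>

lemma has_vector_derivative_bound:
  fixes f :: "real \<Rightarrow> 'a::real_normed_vector"
  assumes "convex S" and "\<And>t. t \<in> S \<Longrightarrow> (f has_vector_derivative f' t) (at t within S)"
    and "\<And>t. t \<in> S \<Longrightarrow> norm (f' t) \<le> B" and "s \<in> S" "t \<in> S"
  shows "norm (f s - f t) \<le> B * \<bar>s - t\<bar>"
proof -
  have "norm (f s - f t) \<le> B * norm (s - t)"
  proof (rule differentiable_bound[OF assms(1) _ _ assms(4,5)])
    show "(f has_derivative (\<lambda>h. h *\<^sub>R f' t)) (at t within S)" if "t \<in> S" for t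
      using assms(2)[OF that] by (simp add: has_vector_derivative_def)
    show "onorm (\<lambda>h. h *\<^sub>R f' t) \<le> B" if "t \<in> S" for t
      using assms(3)[OF that]
      by (intro onorm_le) (simp add: mult.commute[of B] mult_left_mono)
  qed
  then show ?thesis by simp
qed

text \<open>The Picard operator of a globally Lipschitz field is a contraction for the sup distance
  on a short time interval, so Banach's theorem yields a fixed point.\<close>

lemma picard_lindelof_global:
  fixes F :: "'a::banach \<Rightarrow> 'a"
  assumes "K-lipschitz_on UNIV F"
  obtains a x where "0 < a" "x 0 = x0"
    "\<And>t. t \<in> {-a<..<a} \<Longrightarrow> (x has_vector_derivative F (x t)) (at t)"
proof -
  have K: "0 \<le> K" using assms by (simp add: lipschitz_on_def)
  \<comment> \<open>This length gives \<open>K * a < 1\<close>, and the summand 1 keeps the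
    denominator positive when \<open>K = 0\<close>.\<close>
  define a where "a = 1 / (2 * K + 1)"
  have a: "0 < a" "K * a < 1" using K by (auto simp: a_def field_simps)
  \<comment> \<open>Starting both integrals at \<open>-a\<close> makes their difference the signed
    integral from 0 to \<open>t\<close>, also for negative \<open>t\<close>.\<close>
  define h where "h y t = x0 + integral {-a..t} (\<lambda>s. F (apply_bcontfun y s))
      - integral {-a..0} (\<lambda>s. F (apply_bcontfun y s))" for y t
  have contF: "continuous_on S (\<lambda>s. F (apply_bcontfun y s))" for y :: "real \<Rightarrow>\<^sub>C 'a" and S
    by (rule continuous_on_compose2[OF lipschitz_on_continuous_on[OF assms]]) auto
  have h_deriv: "(h y has_vector_derivative F (apply_bcontfun y t)) (at t within {-a..a})"
    if "t \<in> {-a..a}" for y t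
    unfolding h_def using integral_has_vector_derivative[OF contF that]
    by (auto intro!: derivative_eq_intros)
  have h0: "h y 0 = x0" for y by (simp add: h_def)
  have h_cont: "continuous_on (cbox (-a) a) (h y)" for y
    unfolding continuous_on_eq_continuous_within
    using h_deriv has_vector_derivative_continuous by fastforce
  \<comment> \<open>Clamping the time to \<open>[-a, a]\<close> gives a bounded continuous function
    on the whole line, hence a point of a complete metric space.\<close>
  define \<Phi> where "\<Phi> y = Bcontfun (\<lambda>t. h y (clamp (-a) a t))" for y
  have "(\<lambda>t. h y (clamp (-a) a t)) \<in> bcontfun" for y
    unfolding bcontfun_def
    using clamp_continuous_on[OF h_cont[of y], where S = UNIV]
      clamp_bounded[OF compact_imp_bounded[OF compact_continuous_image[OF h_cont[of y] compact_cbox]]]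
    by blast
  then have \<Phi>: "apply_bcontfun (\<Phi> y) t = h y (clamp (-a) a t)" for y t
    by (simp add: \<Phi>_def Bcontfun_inverse)
  have "dist (\<Phi> y) (\<Phi> z) \<le> (K * a) * dist y z" for y z
  proof (rule dist_bound)
    fix t
    define c where "c = clamp (-a) a t"
    have c: "c \<in> {-a..a}" unfolding c_def using clamp_in_interval[of "-a" a t] a by simp
    \<comment> \<open>Both images take the value \<open>x0\<close> at time 0, so a bound on the
      derivative of their difference bounds the difference itself.\<close>
    have "norm ((h y c - h z c) - (h y 0 - h z 0)) \<le> (K * dist y z) * \<bar>c - 0\<bar>"
    proof (rule has_vector_derivative_bound)
      show "((\<lambda>t. h y t - h z t) has_vector_derivative
          F (apply_bcontfun y t) - F (apply_bcontfun z t)) (at t within {-a..a})"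
        if "t \<in> {-a..a}" for t
        by (intro derivative_intros h_deriv that)
      show "norm (F (apply_bcontfun y t) - F (apply_bcontfun z t)) \<le> K * dist y z" for t
        using lipschitz_onD[OF assms, of "apply_bcontfun y t" "apply_bcontfun z t"]
          mult_left_mono[OF dist_bounded[of y t z] K] by (simp add: dist_norm)
    qed (use a c in auto)
    also have "\<dots> \<le> (K * dist y z) * a"
      using c K by (intro mult_left_mono) auto
    finally show "dist (apply_bcontfun (\<Phi> y) t) (apply_bcontfun (\<Phi> z) t) \<le> (K * a) * dist y z"
      by (simp add: \<Phi> h0 c_def dist_norm algebra_simps)
  qed
  then have "\<exists>!y. \<Phi> y = y"
    using K a by (intro banach_fix_type) auto
  then obtain y where y: "\<Phi> y = y" by blast
  have yh: "apply_bcontfun y t = h y t" if "t \<in> {-a..a}" for t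
    using \<Phi>[of y t] that by (simp add: y)
  show ?thesis
  proof (rule that[of a "apply_bcontfun y"])
    show "apply_bcontfun y 0 = x0" using yh[of 0] a by (simp add: h0)
    fix t assume t: "t \<in> {-a<..<a}"
    have "(h y has_vector_derivative F (apply_bcontfun y t)) (at t)"
      using h_deriv[of t y] t by (simp add: at_within_Icc_at)
    then show "(apply_bcontfun y has_vector_derivative F (apply_bcontfun y t)) (at t)"
      by (rule has_vector_derivative_transform_within_open[where S = "{-a<..<a}"])
        (use t yh in auto)
  qed (use a in auto)
qed

text \<open>The nearest-point map \<open>p\<close> of the ball is 1-Lipschitz, so
  \<open>F \<circ> p\<close> is globally Lipschitz. Its solution stays in the ball for a short time
  by continuity, and there \<open>p\<close> is the identity.\<close>

lemma picard_lindelof: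
  fixes F :: "'a::euclidean_space \<Rightarrow> 'a"
  assumes "K-lipschitz_on (cball x0 r) F" "0 < r"
  obtains T x where "solves_ode F T x" "x 0 = x0"
proof -
  define p where "p = closest_point (cball x0 r)"
  have p: "p x \<in> cball x0 r" for x
    unfolding p_def using assms(2) by (intro closest_point_in_set) auto
  have "K-lipschitz_on UNIV (F \<circ> p)"
  proof (rule lipschitz_onI)
    fix x y
    have "dist (p x) (p y) \<le> dist x y"
      unfolding p_def using assms(2) by (intro closest_point_lipschitz) auto
    then show "dist ((F \<circ> p) x) ((F \<circ> p) y) \<le> K * dist x y"
      using lipschitz_onD[OF assms(1) p p, of x y] lipschitz_on_nonneg[OF assms(1)]
      by (auto intro: order_trans mult_left_mono)
  qed (rule lipschitz_on_nonneg[OF assms(1)])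
  then obtain a x where a: "0 < a" and x0: "x 0 = x0"
    and x: "\<And>t. t \<in> {-a<..<a} \<Longrightarrow> (x has_vector_derivative (F \<circ> p) (x t)) (at t)"
    using picard_lindelof_global by blast
  have "isCont x 0" using x[of 0] a has_vector_derivative_continuous by auto
  then obtain d where d: "0 < d" "\<And>t. dist t 0 < d \<Longrightarrow> dist (x t) (x 0) < r"
    using assms(2) unfolding continuous_at_eps_delta by blast
  define b where "b = min a d"
  have "solves_ode F {-b<..<b} x"
    unfolding solves_ode_def
  proof (intro conjI ballI)
    fix t assume t: "t \<in> {-b<..<b}"
    then have "x t \<in> cball x0 r"
      using d(2)[of t] x0 by (auto simp: b_def dist_commute less_imp_le)
    then have "p (x t) = x t" by (simp add: p_def closest_point_self)
    then show "(x has_vector_derivative F (x t)) (at t)"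
      using x[of t] t by (auto simp: b_def)
  qed (use a d in \<open>auto simp: b_def\<close>)
  then show ?thesis using that x0 by blast
qed

section \<open>Dynamic invariance of a subspace in terms of the field\<close>

lemma subspace_projection:
  fixes W :: "'a::euclidean_space set"
  assumes "subspace W"
  obtains p where "bounded_linear p" "\<And>v. p v \<in> W" "\<And>v. v \<in> W \<Longrightarrow> p v = v"
proof -
  obtain p where "range p \<subseteq> W" "linear p" "\<forall>v\<in>W. p (id v) = v"
    using linear_exists_left_inverse_on[OF linear_id assms] by auto
  then show ?thesis
    using that[of p] by (simp add: image_subset_iff linear_conv_bounded_linear)
qed

text \<open>A projection \<open>p\<close> onto \<open>W\<close> turns membership into the equation
  \<open>p v = v\<close>, which survives differentiation because \<open>p\<close> is linear and
  bounded.\<close>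

lemma vector_derivative_in_subspace:
  fixes x :: "real \<Rightarrow> 'a::euclidean_space"
  assumes "subspace W" "(x has_vector_derivative v) (at t)" "open T" "t \<in> T" "\<And>s. s \<in> T \<Longrightarrow> x s \<in> W"
  shows "v \<in> W"
proof -
  obtain p where p: "bounded_linear p" "\<And>v. p v \<in> W" "\<And>v. v \<in> W \<Longrightarrow> p v = v"
    using subspace_projection[OF assms(1)] by blast
  have "((\<lambda>s. p (x s)) has_vector_derivative p v) (at t)"
    by (rule bounded_linear.has_vector_derivative[OF p(1) assms(2)])
  then have "(x has_vector_derivative p v) (at t)"
    by (rule has_vector_derivative_transform_within_open[OF _ assms(3,4)]) (simp add: p assms)
  then have "v = p v" by (rule vector_derivative_unique_at[OF assms(2)])
  then show ?thesis using p(2)[of v] by metis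
qed

text \<open>Local existence keeps the invariance from being vacuous at \<open>x0\<close>: the
  solution through \<open>x0\<close> lies in \<open>W\<close>, and its velocity at time 0 is
  \<open>F x0\<close>.\<close>

lemma dynamically_invariant_imp_field_in:
  fixes F :: "'a::euclidean_space \<Rightarrow> 'a"
  assumes "subspace W" "dynamically_invariant F W" "x0 \<in> W"
    and "K-lipschitz_on (cball x0 r) F" "0 < r"
  shows "F x0 \<in> W"
proof -
  obtain T x where "solves_ode F T x" and x0: "x 0 = x0"
    using picard_lindelof assms(4,5) by blast
  then have T: "open T" "0 \<in> T" "(x has_vector_derivative F x0) (at 0)"
    and "\<And>t. t \<in> T \<Longrightarrow> x t \<in> W"
    using assms(2,3) by (auto simp: solves_ode_def dynamically_invariant_def)
  then show ?thesis
    using vector_derivative_in_subspace[OF assms(1) T(3,1,2)] by blast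
qed

text \<open>The squared norm of \<open>y\<close>, multiplied by \<open>exp (c * t)\<close>, does not
  grow when moving away from \<open>t0\<close>. To the right this takes \<open>c = -2 * K\<close>,
  to the left \<open>c = 2 * K\<close>. It vanishes at \<open>t0\<close>, hence everywhere.\<close>

lemma gronwall_zero:
  fixes y :: "real \<Rightarrow> 'a::real_inner"
  assumes "\<And>t. t \<in> {a..b} \<Longrightarrow> (y has_vector_derivative y' t) (at t)"
    and "\<And>t. t \<in> {a..b} \<Longrightarrow> norm (y' t) \<le> K * norm (y t)"
    and "t0 \<in> {a..b}" "y t0 = 0" "t \<in> {a..b}"
  shows "y t = 0"
proof -
  have d: "((\<lambda>t. (y t \<bullet> y t) * exp (c * t)) has_real_derivative
      (2 * (y t \<bullet> y' t) + c * (y t \<bullet> y t)) * exp (c * t)) (at t)" if "t \<in> {a..b}" for t c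
    using assms(1)[OF that]
    unfolding has_vector_derivative_def has_field_derivative_def
    by (auto intro!: derivative_eq_intros simp: inner_commute algebra_simps fun_eq_iff)
  have bd: "\<bar>2 * (y t \<bullet> y' t)\<bar> \<le> (2 * K) * (y t \<bullet> y t)" if "t \<in> {a..b}" for t
  proof -
    have "\<bar>y t \<bullet> y' t\<bar> \<le> norm (y t) * norm (y' t)" by (rule Cauchy_Schwarz_ineq2)
    also have "\<dots> \<le> norm (y t) * (K * norm (y t))" by (intro mult_left_mono assms(2) that) auto
    finally show ?thesis by (simp add: dot_square_norm power2_eq_square algebra_simps)
  qed
  have "(y t \<bullet> y t) * exp (c * t) \<le> 0" if "c = (if t0 \<le> t then -2 * K else 2 * K)" for c
  proof (cases "t0 \<le> t")
    case True
    have "(y t \<bullet> y t) * exp (c * t) \<le> (y t0 \<bullet> y t0) * exp (c * t0)"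
    proof (rule DERIV_nonpos_imp_nonincreasing[OF True])
      fix s assume "t0 \<le> s" "s \<le> t"
      then have s: "s \<in> {a..b}" using assms by auto
      have "2 * (y s \<bullet> y' s) + c * (y s \<bullet> y s) \<le> 0"
        using bd[OF s] that True by auto
      then have "(2 * (y s \<bullet> y' s) + c * (y s \<bullet> y s)) * exp (c * s) \<le> 0"
        by (simp add: mult_nonpos_nonneg)
      then show "\<exists>D. ((\<lambda>t. (y t \<bullet> y t) * exp (c * t)) has_real_derivative D) (at s) \<and> D \<le> 0"
        using d[OF s] by blast
    qed
    then show ?thesis by (simp add: assms)
  next
    case False
    then have le: "t \<le> t0" by simp
    have "(y t \<bullet> y t) * exp (c * t) \<le> (y t0 \<bullet> y t0) * exp (c * t0)"
    proof (rule DERIV_nonneg_imp_nondecreasing[OF le])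
      fix s assume "t \<le> s" "s \<le> t0"
      then have s: "s \<in> {a..b}" using assms by auto
      have "0 \<le> 2 * (y s \<bullet> y' s) + c * (y s \<bullet> y s)"
        using bd[OF s] that False by auto
      then have "0 \<le> (2 * (y s \<bullet> y' s) + c * (y s \<bullet> y s)) * exp (c * s)"
        by simp
      then show "\<exists>D. ((\<lambda>t. (y t \<bullet> y t) * exp (c * t)) has_real_derivative D) (at s) \<and> 0 \<le> D"
        using d[OF s] by blast
    qed
    then show ?thesis by (simp add: assms)
  qed
  then have "y t \<bullet> y t \<le> 0" by (auto simp: mult_le_0_iff)
  then show ?thesis using inner_gt_zero_iff[of "y t"] by (auto simp: not_less[symmetric])
qed

text \<open>The defect \<open>x t - p (x t)\<close> measures how far a solution has left
  \<open>W\<close>. It starts at 0, and its derivative is bounded by a multiple of its norm, so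
  Gronwall keeps it at 0.\<close>

lemma dynamically_invariantI:
  fixes F :: "'a::euclidean_space \<Rightarrow> 'a"
  assumes W: "subspace W" and FW: "\<And>x. x \<in> W \<Longrightarrow> F x \<in> W"
    and lip: "\<And>r. \<exists>K. K-lipschitz_on (cball 0 r) F"
  shows "dynamically_invariant F W"
  unfolding dynamically_invariant_def
proof (intro allI impI ballI)
  fix T x t1 assume sol: "solves_ode F T x" and x0: "x 0 \<in> W" and t1: "t1 \<in> T"
  obtain p where p: "bounded_linear p" "\<And>v. p v \<in> W" "\<And>v. v \<in> W \<Longrightarrow> p v = v"
    using subspace_projection[OF W] by blast
  then obtain C where C: "\<And>v. norm (p v) \<le> norm v * C" "0 \<le> C"
    using bounded_linear.nonneg_bounded by blast
  define J where "J = {min 0 t1..max 0 t1}"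
  have JT: "J \<subseteq> T" using sol t1 unfolding J_def solves_ode_def
    by (metis (no_types) is_interval_connected_1 connected_contains_Icc max_def min_def)
  have deriv: "(x has_vector_derivative F (x t)) (at t)" if "t \<in> J" for t
    using sol that JT by (auto simp: solves_ode_def)
  have "continuous_on J x"
    using deriv has_vector_derivative_continuous continuous_at_imp_continuous_on by blast
  then have "bounded (x ` J)"
    by (intro compact_imp_bounded compact_continuous_image) (auto simp: J_def)
  then obtain R where R: "0 \<le> R" "\<And>t. t \<in> J \<Longrightarrow> norm (x t) \<le> R"
    by (metis bounded_pos imageI less_imp_le)
  \<comment> \<open>\<open>R\<close> bounds the solution on \<open>J\<close> and
    \<open>R * C\<close> bounds its projection, so one ball, with one Lipschitz constant, contains
    both.\<close>
  define r where "r = R + R * C"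
  have xr: "x t \<in> cball 0 r" "p (x t) \<in> cball 0 r" if "t \<in> J" for t
    using R(2)[OF that] R(1) C(1)[of "x t"] C(2) mult_right_mono[OF R(2)[OF that] C(2)]
    by (auto simp: r_def mem_cball_0 intro: add_increasing2)
  obtain K where K: "K-lipschitz_on (cball 0 r) F" using lip by blast
  have "x t1 - p (x t1) = 0"
  proof (rule gronwall_zero)
    show "((\<lambda>t. x t - p (x t)) has_vector_derivative F (x t) - p (F (x t))) (at t)"
      if "t \<in> {min 0 t1..max 0 t1}" for t
      using deriv[unfolded J_def, OF that]
      by (intro has_vector_derivative_diff bounded_linear.has_vector_derivative[OF p(1)])
    fix t assume "t \<in> {min 0 t1..max 0 t1}"
    then have t: "t \<in> J" by (simp add: J_def)
    \<comment> \<open>Since \<open>F (p (x t))\<close> lies in \<open>W\<close> and is fixed by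
      \<open>p\<close>, it cancels from the derivative of the defect, leaving
      \<open>w - p w\<close>. The Lipschitz bound controls \<open>w\<close> by the defect.\<close>
    define w where "w = F (x t) - F (p (x t))"
    have "p (F (p (x t))) = F (p (x t))" by (rule p(3)[OF FW[OF p(2)]])
    then have "F (x t) - p (F (x t)) = w - p w"
      using p(1) by (simp add: w_def linear_diff bounded_linear.linear)
    also have "norm \<dots> \<le> norm w + norm w * C"
      using norm_triangle_ineq4[of w "p w"] C(1)[of w] by linarith
    also have "\<dots> = (1 + C) * norm w" by (simp add: algebra_simps)
    also have "\<dots> \<le> (1 + C) * (K * norm (x t - p (x t)))"
      using lipschitz_onD[OF K xr[OF t]] C(2)
      by (intro mult_left_mono) (auto simp: w_def dist_norm)
    finally show "norm (F (x t) - p (F (x t))) \<le> ((1 + C) * K) * norm (x t - p (x t))"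
      by (simp add: mult.assoc)
  next
    show "x 0 - p (x 0) = 0" using p(3) x0 by simp
  qed auto
  then have "x t1 = p (x t1)" by simp
  then show "x t1 \<in> W" using p(2) by metis
qed

subsection \<open>Smooth functions and interpolation\<close>

text \<open>Closure under directional derivatives makes polynomial maps smooth. Structural induction
  handles real-valued polynomials; uniqueness of derivatives transfers the result to the components
  of \<open>p\<close>.\<close>

lemma polynomial_function_frechet_derivative:
  fixes p :: "'a::euclidean_space \<Rightarrow> 'b::euclidean_space"
  assumes "polynomial_function p"
  shows "polynomial_function (\<lambda>x. frechet_derivative p (at x) v)"
proof -
  have real_case: "\<exists>q'. (\<forall>x. (q has_derivative q' x) (at x)) \<and> (\<forall>v. real_polynomial_function (\<lambda>x. q' x v))"
    if "real_polynomial_function q" for q :: "'a \<Rightarrow> real"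
    using that
  proof induction
    case (linear f)
    then show ?case
      by (intro exI[of _ "\<lambda>_. f"])
        (simp add: real_polynomial_function.intros(2) bounded_linear_imp_has_derivative)
  next
    case (const c)
    show ?case by (intro exI[of _ "\<lambda>_ _. 0"]) (simp add: real_polynomial_function.intros(2))
  next
    case (add f g)
    from add.IH obtain f' g' where "\<And>x. (f has_derivative f' x) (at x)" "\<And>x. (g has_derivative g' x) (at x)"
      and "\<And>v. real_polynomial_function (\<lambda>x. f' x v)" "\<And>v. real_polynomial_function (\<lambda>x. g' x v)"
      by metis
    then show ?case
      by (intro exI[of _ "\<lambda>x v. f' x v + g' x v"])
        (simp add: has_derivative_add real_polynomial_function.intros(3))
  next
    case (mult f g)
    from mult.IH obtain f' g' where "\<And>x. (f has_derivative f' x) (at x)" "\<And>x. (g has_derivative g' x) (at x)"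
      and "\<And>v. real_polynomial_function (\<lambda>x. f' x v)" "\<And>v. real_polynomial_function (\<lambda>x. g' x v)"
      by metis
    with mult.hyps show ?case
      by (intro exI[of _ "\<lambda>x v. f x * g' x v + f' x v * g x"])
        (simp add: has_derivative_mult real_polynomial_function.intros(3) real_polynomial_function.intros(4))
  qed
  have "real_polynomial_function (\<lambda>x. frechet_derivative p (at x) v \<bullet> b)" for b
  proof -
    have "real_polynomial_function (\<lambda>x. p x \<bullet> b)"
      using assms bounded_linear_inner_left[of b] by (auto simp: polynomial_function_def o_def)
    then obtain q' where q': "\<forall>x. ((\<lambda>x. p x \<bullet> b) has_derivative q' x) (at x)"
      "\<forall>v. real_polynomial_function (\<lambda>x. q' x v)" using real_case by blast
    have "((\<lambda>x. p x \<bullet> b) has_derivative (\<lambda>v. frechet_derivative p (at x) v \<bullet> b)) (at x)" for x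
      using differentiable_at_polynomial_function[OF assms, of x UNIV]
      by (intro has_derivative_inner_left) (simp add: frechet_derivative_works)
    then have "(\<lambda>v. frechet_derivative p (at x) v \<bullet> b) = q' x" for x
      using q'(1) has_derivative_unique by blast
    then have "frechet_derivative p (at x) v \<bullet> b = q' x v" for x by metis
    then show ?thesis using q'(2) by simp
  qed
  then show ?thesis by (simp add: polynomial_function_iff_Basis_inner)
qed

lemma smooth_polynomial_function:
  fixes p :: "'a::euclidean_space \<Rightarrow> 'b::euclidean_space"
  assumes "polynomial_function p"
  shows "smooth p"
proof -
  have "C_diff m p" for m
    using assms
  proof (induction m arbitrary: p)
    case 0
    then show ?case by (simp add: continuous_on_polymonial_function)
  next
    case (Suc m)
    then show ?case
      using differentiable_at_polynomial_function[OF Suc.prems, of _ UNIV]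
      by (simp add: polynomial_function_frechet_derivative)
  qed
  then show ?thesis by (simp add: smooth_def)
qed

text \<open>Lagrange interpolation in several variables: the linear factors of the one-variable
  formula are replaced by squared distances to the other nodes.\<close>

lemma polynomial_interpolation:
  fixes S :: "'a::euclidean_space set" and \<phi> :: "'a \<Rightarrow> 'b::euclidean_space"
  assumes "finite S"
  obtains p where "polynomial_function p" "\<And>x. x \<in> S \<Longrightarrow> p x = \<phi> x"
proof -
  define l where "l a x = (\<Prod>b\<in>S - {a}. ((x - b) \<bullet> (x - b)) / ((a - b) \<bullet> (a - b)))" for a x
  define p where "p x = (\<Sum>a\<in>S. l a x *\<^sub>R \<phi> a)" for x
  have "real_polynomial_function (\<lambda>x. (x - b) \<bullet> (x - b))" for b :: 'a
  proof -
    have "(x - b) \<bullet> (x - b) = (\<Sum>i\<in>Basis. ((x - b) \<bullet> i) * ((x - b) \<bullet> i))" for x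
      by (rule euclidean_inner)
    moreover have "polynomial_function (\<lambda>x. (x - b) \<bullet> i)" for i
      by (intro polynomial_function_inner polynomial_function_diff) auto
    ultimately show ?thesis
      by (simp add: real_polynomial_function_sum real_polynomial_function.intros(4)
          flip: real_polynomial_function_eq)
  qed
  then have "polynomial_function (l a)" for a
    unfolding l_def real_polynomial_function_eq[symmetric]
    using assms by (intro real_polynomial_function_prod real_polynomial_function_divide) auto
  then have "polynomial_function p"
    unfolding p_def using assms
    by (intro polynomial_function_sum polynomial_function_mult) auto
  moreover have "p x = \<phi> x" if "x \<in> S" for x
  proof -
    have "l a x = (if a = x then 1 else 0)" if "a \<in> S" for a
      using \<open>x \<in> S\<close> assms by (auto simp: l_def intro!: prod.neutral prod_zero)
    then have "p x = (\<Sum>a\<in>S. if a = x then \<phi> a else 0)"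
      unfolding p_def by (intro sum.cong) auto
    then show ?thesis using that assms by simp
  qed
  ultimately show ?thesis using that by blast
qed

text \<open>On the compact ball the finitely many partial derivatives are bounded. The sum of their
  norms dominates the operator norm, and the mean value inequality applies as the ball is
  convex.\<close>

lemma smooth_lipschitz_on_cball:
  fixes f :: "'a::euclidean_space \<Rightarrow> 'b::real_normed_vector"
  assumes "smooth f"
  shows "\<exists>K. K-lipschitz_on (cball a r) f"
proof -
  have "C_diff 1 f" using assms by (simp add: smooth_def)
  then have diff: "\<And>x. (f has_derivative frechet_derivative f (at x)) (at x)"
    and cont: "\<And>v. continuous_on UNIV (\<lambda>x. frechet_derivative f (at x) v)"
    by (auto simp: frechet_derivative_works)
  have "continuous_on (cball a r) (\<lambda>x. \<Sum>b\<in>Basis. norm (frechet_derivative f (at x) b))"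
    by (intro continuous_intros continuous_on_subset[OF cont]) auto
  then have "bounded ((\<lambda>x. \<Sum>b\<in>Basis. norm (frechet_derivative f (at x) b)) ` cball a r)"
    by (intro compact_imp_bounded compact_continuous_image) auto
  then obtain K where "0 < K"
    and "\<forall>y\<in>(\<lambda>x. \<Sum>b\<in>Basis. norm (frechet_derivative f (at x) b)) ` cball a r. norm y \<le> K"
    unfolding bounded_pos by blast
  then have K: "0 < K"
    "\<And>x. x \<in> cball a r \<Longrightarrow> (\<Sum>b\<in>Basis. norm (frechet_derivative f (at x) b)) \<le> K"
    by (auto dest: abs_le_D1)
  have "K-lipschitz_on (cball a r) f"
  proof (rule lipschitz_onI)
    fix x y assume "x \<in> cball a r" "y \<in> cball a r"
    then have "norm (f x - f y) \<le> K * norm (x - y)"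
    proof (rule differentiable_bound[rotated 3])
      fix z assume "z \<in> cball a r"
      then show "onorm (frechet_derivative f (at z)) \<le> K"
        using K(2) onorm_componentwise[OF has_derivative_bounded_linear[OF diff[of z]]] by force
    qed (use has_derivative_at_withinI[OF diff] in auto)
    then show "dist (f x) (f y) \<le> K * dist x y" by (simp add: dist_norm)
  qed (use K in simp)
  then show ?thesis by blast
qed

section \<open>Lipschitz bounds for the network field\<close>

lemma lipschitz_on_vec:
  fixes F :: "'a::metric_space \<Rightarrow> ('b::real_normed_vector) ^ 'n"
  assumes "\<And>i. (K i)-lipschitz_on S (\<lambda>x. F x $ i)"
  shows "(\<Sum>i\<in>UNIV. K i)-lipschitz_on S F"
proof (rule lipschitz_onI)
  fix x y assume "x \<in> S" "y \<in> S"
  have "dist (F x) (F y) \<le> (\<Sum>i\<in>UNIV. dist (F x $ i) (F y $ i))"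
    unfolding dist_norm norm_vec_def by (rule order_trans[OF L2_set_le_sum]) auto
  also have "\<dots> \<le> (\<Sum>i\<in>UNIV. K i * dist x y)"
    using assms \<open>x \<in> S\<close> \<open>y \<in> S\<close> by (intro sum_mono) (auto dest: lipschitz_onD)
  finally show "dist (F x) (F y) \<le> (\<Sum>i\<in>UNIV. K i) * dist x y"
    by (simp add: sum_distrib_right)
qed (use assms lipschitz_on_nonneg in \<open>auto intro!: sum_nonneg\<close>)

lemma network_field_lipschitz_on_cball:
  fixes f :: "real^'k \<Rightarrow> real^'k" and M :: "real^'n^'n"
  assumes "smooth f"
  shows "\<exists>K. K-lipschitz_on (cball 0 r) (network_field M H f)"
proof -
  obtain K where K: "K-lipschitz_on (cball 0 r) f"
    using smooth_lipschitz_on_cball[OF assms] by blast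
  have "\<exists>L. L-lipschitz_on (cball 0 r) (\<lambda>x. network_field M H f x $ i)" for i
  proof -
    have "1-lipschitz_on (cball 0 r) (\<lambda>x::real^'k^'n. x $ i)"
      by (rule lipschitz_onI) (simp_all add: dist_vec_nth_le)
    moreover have "K-lipschitz_on ((\<lambda>x::real^'k^'n. x $ i) ` cball 0 r) f"
      by (rule lipschitz_on_subset[OF K]) (auto intro: order_trans[OF Finite_Cartesian_Product.norm_nth_le])
    ultimately have 1: "(K * 1)-lipschitz_on (cball 0 r) (\<lambda>x. f (x $ i))"
      by (rule lipschitz_on_compose2)
    have "bounded_linear (\<lambda>x. H *v (\<Sum>j\<in>UNIV. M $ i $ j *\<^sub>R x $ j))"
      by (intro bounded_linear_compose[OF matrix_vector_mul_bounded_linear] bounded_linear_sum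
          bounded_linear_compose[OF bounded_linear_scaleR_right] bounded_linear_vec_nth)
    then obtain B where "B-lipschitz_on (cball 0 r) (\<lambda>x. H *v (\<Sum>j\<in>UNIV. M $ i $ j *\<^sub>R x $ j))"
      using bounded_linear.lipschitz_boundE by blast
    from lipschitz_on_add[OF 1 this] show ?thesis
      by (auto simp: network_field_def)
  qed
  then obtain L where "\<And>i. (L i)-lipschitz_on (cball 0 r) (\<lambda>x. network_field M H f x $ i)"
    by metis
  then show ?thesis using lipschitz_on_vec by blast
qed

subsection \<open>The network vector field on polydiagonal subspaces\<close>

text \<open>This removes the dynamics: from here on it only matters whether the field maps
  \<open>W\<close> into itself.\<close>

lemma dynamically_invariant_network_iff:
  assumes "subspace W" "smooth f"
  shows "dynamically_invariant (network_field M H f) W \<longleftrightarrow> (\<forall>x\<in>W. network_field M H f x \<in> W)"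
proof
  assume inv: "dynamically_invariant (network_field M H f) W"
  show "\<forall>x\<in>W. network_field M H f x \<in> W"
  proof
    fix x assume x: "x \<in> W"
    obtain K where "K-lipschitz_on (cball 0 (norm x + 1)) (network_field M H f)"
      using network_field_lipschitz_on_cball[OF assms(2)] by blast
    then have "K-lipschitz_on (cball x 1) (network_field M H f)"
    proof (rule lipschitz_on_subset)
      show "cball x 1 \<subseteq> cball 0 (norm x + 1)"
      proof
        fix y assume "y \<in> cball x 1"
        then show "y \<in> cball 0 (norm x + 1)"
          using norm_triangle_sub[of y x] by (simp add: dist_norm norm_minus_commute)
      qed
    qed
    then show "network_field M H f x \<in> W"
      using dynamically_invariant_imp_field_in[OF assms(1) inv x] by simp
  qed
next
  assume "\<forall>x\<in>W. network_field M H f x \<in> W"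
  then show "dynamically_invariant (network_field M H f) W"
    using dynamically_invariantI[OF assms(1)] network_field_lipschitz_on_cball[OF assms(2)] by blast
qed

text \<open>Working with the \<open>k\<close> coordinate slices separately carries invariance under
  \<open>M\<close> between the two spaces.\<close>

lemma mem_tensor_polydiagonal_iff:
  "x \<in> tensor_polydiagonal P s \<longleftrightarrow> (\<forall>a. (\<chi> i. x $ i $ a) \<in> polydiagonal P s)"
  unfolding tensor_polydiagonal_def polydiagonal_def by (simp add: vec_eq_iff) blast

lemma polydiagonal_cmult:
  assumes "c \<noteq> 0"
  shows "(\<chi> i. c * u $ i) \<in> polydiagonal P s \<longleftrightarrow> u \<in> polydiagonal P s"
proof -
  have "c * a = - (c * b) \<longleftrightarrow> a = - b" for a b :: real
    using assms by (metis mult_cancel_left mult_minus_right)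
  then show ?thesis using assms by (simp add: polydiagonal_def)
qed

text \<open>The coupling applies \<open>M\<close> to each slice and then the linear map
  \<open>H\<close> to each cell, which preserves equalities and sign changes. Equal cells stay equal
  under any \<open>f\<close>, so only tagged pairs impose a condition on \<open>f\<close>.\<close>

lemma network_field_in_tensor_polydiagonal:
  assumes inv: "matrix_invariant M (polydiagonal P s)" and x: "x \<in> tensor_polydiagonal P s"
    and f: "\<And>i j. s (class_of P i) = Some (class_of P j) \<Longrightarrow> f (x $ i) = - f (x $ j)"
  shows "network_field M H f x \<in> tensor_polydiagonal P s"
proof -
  define L where "L = (\<chi> i. \<Sum>j\<in>UNIV. M $ i $ j *\<^sub>R x $ j)"
  have "M *v (\<chi> i. x $ i $ a) \<in> polydiagonal P s" for a
    using inv x unfolding matrix_invariant_def mem_tensor_polydiagonal_iff by blast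
  moreover have "M *v (\<chi> i. x $ i $ a) = (\<chi> i. L $ i $ a)" for a
    by (simp add: L_def matrix_vector_mult_def vec_eq_iff)
  ultimately have L: "L \<in> tensor_polydiagonal P s"
    unfolding mem_tensor_polydiagonal_iff by metis
  have field: "network_field M H f x $ i = f (x $ i) + H *v (L $ i)" for i
    by (simp add: network_field_def L_def)
  show ?thesis
    unfolding tensor_polydiagonal_def mem_Collect_eq
  proof (intro conjI allI impI)
    fix i j
    show "network_field M H f x $ i = network_field M H f x $ j" if "class_of P i = class_of P j"
    proof -
      have "x $ i = x $ j" "L $ i = L $ j"
        using x L that unfolding tensor_polydiagonal_def by blast+
      then show ?thesis by (simp only: field)
    qed
    show "network_field M H f x $ i = - network_field M H f x $ j"
      if "s (class_of P i) = Some (class_of P j)"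
    proof -
      have "L $ i = - L $ j"
        using L that unfolding tensor_polydiagonal_def by blast
      moreover have "H *v (- L $ j) = - (H *v L $ j)"
        using matrix_vector_mult_scaleR[of H "-1" "L $ j"] by simp
      ultimately show ?thesis by (simp add: field f[OF that])
    qed
  qed
qed

text \<open>With \<open>f = 0\<close> only the coupling remains. For an entry
  \<open>H $ a $ b \<noteq> 0\<close>, place \<open>u\<close> in slice \<open>b\<close> and 0 in all
  others: slice \<open>a\<close> of the image is that entry times \<open>M *v u\<close>, and the
  nonzero factor can be cancelled.\<close>

lemma matrix_invariant_polydiagonal:
  fixes H :: "real^'k^'k"
  assumes "H \<noteq> 0"
    and inv: "\<And>x. x \<in> tensor_polydiagonal P s \<Longrightarrow> network_field M H (\<lambda>_. 0) x \<in> tensor_polydiagonal P s"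
  shows "matrix_invariant M (polydiagonal P s)"
  unfolding matrix_invariant_def
proof safe
  fix u assume u: "u \<in> polydiagonal P s"
  obtain a b where ab: "H $ a $ b \<noteq> 0" using assms(1) by (auto simp: vec_eq_iff)
  define x where "x = (\<chi> j. u $ j *\<^sub>R (axis b 1 :: real^'k))"
  have "(\<chi> i. x $ i $ c) \<in> polydiagonal P s" for c
  proof (cases "c = b")
    case True
    then show ?thesis using u by (simp add: x_def)
  next
    case False
    then show ?thesis by (simp add: x_def axis_def polydiagonal_def)
  qed
  then have "x \<in> tensor_polydiagonal P s"
    unfolding mem_tensor_polydiagonal_iff by blast
  then have "(\<chi> i. network_field M H (\<lambda>_. 0) x $ i $ a) \<in> polydiagonal P s"
    using inv unfolding mem_tensor_polydiagonal_iff by blast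
  moreover have "network_field M H (\<lambda>_. 0) x $ i $ a = H $ a $ b * (M *v u) $ i" for i
  proof -
    have "(\<Sum>j\<in>UNIV. M $ i $ j *\<^sub>R x $ j) = (M *v u) $ i *\<^sub>R axis b 1"
      by (simp add: x_def matrix_vector_mult_def scaleR_sum_left)
    then show ?thesis
      by (simp add: network_field_def matrix_vector_mult_scaleR matrix_vector_mult_basis column_def)
  qed
  ultimately show "M *v u \<in> polydiagonal P s"
    using ab by (simp add: polydiagonal_cmult)
qed

subsection \<open>The tagged partition of a subspace\<close>

text \<open>A real vector space is not a finite union of proper subspaces. In the induction the old
  vector \<open>x\<close> is moved along a \<open>w\<close> with \<open>T w \<noteq> 0\<close>;
  finitely many multiples are bad, and the reals are infinite.\<close>

lemma subspace_avoids_kernels: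
  fixes W :: "'a::real_vector set" and \<T> :: "('a \<Rightarrow> 'b::real_vector) set"
  assumes "finite \<T>" "subspace W" "\<And>T. T \<in> \<T> \<Longrightarrow> linear T \<and> (\<exists>w\<in>W. T w \<noteq> 0)"
  shows "\<exists>x\<in>W. \<forall>T\<in>\<T>. T x \<noteq> 0"
  using assms(1,3)
proof (induction rule: finite_induct)
  case empty
  then show ?case using subspace_0[OF assms(2)] by auto
next
  case (insert T \<T>)
  then obtain x where x: "x \<in> W" "\<forall>T\<in>\<T>. T x \<noteq> 0" by auto
  obtain w where w: "w \<in> W" "T w \<noteq> 0" using insert.prems by blast
  \<comment> \<open>If \<open>S w = 0\<close>, then \<open>S\<close> is one of the old maps, so
    \<open>S x \<noteq> 0\<close> and no \<open>c\<close> is bad. Otherwise at most one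
    \<open>c\<close> is bad.\<close>
  have "finite {c. S (x + c *\<^sub>R w) = 0}" if "S \<in> insert T \<T>" for S
  proof -
    have lin: "S (x + c *\<^sub>R w) = S x + c *\<^sub>R S w" for c
      using insert.prems[OF that] by (simp add: linear_add linear_scale)
    show ?thesis
    proof (cases "S w = 0")
      case True
      then have "S x \<noteq> 0" using that x w by auto
      then show ?thesis unfolding lin using True by simp
    next
      case False
      then have "c = d" if "S x + c *\<^sub>R S w = 0" "S x + d *\<^sub>R S w = 0" for c d
        using that by (metis add_left_cancel scaleR_cancel_right)
      then have "{c. S x + c *\<^sub>R S w = 0} = {} \<or> (\<exists>d. {c. S x + c *\<^sub>R S w = 0} = {d})"
        by blast
      then show ?thesis unfolding lin by auto
    qed
  qed
  then have "finite (\<Union>S\<in>insert T \<T>. {c. S (x + c *\<^sub>R w) = 0})"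
    using insert.hyps by blast
  then obtain c where "c \<notin> (\<Union>S\<in>insert T \<T>. {c. S (x + c *\<^sub>R w) = 0})"
    using ex_new_if_finite[OF infinite_UNIV_char_0[where 'a = real]] by blast
  then show ?case
    using x(1) w(1) assms(2)
    by (intro bexI[of _ "x + c *\<^sub>R w"]) (auto intro: subspace_add subspace_scale)
qed

lemma eq_uminus_self_iff: "x = - x \<longleftrightarrow> x = 0" for x :: "'a::real_vector"
  by (metis eq_neg_iff_add_eq_0 minus_zero scaleR_2 scaleR_eq_0_iff zero_neq_numeral)

section \<open>Relations between coordinates that hold on a whole subspace\<close>

definition agree :: "('a ^ 'n) set \<Rightarrow> ('n \<times> 'n) set" where
  "agree W = {(i, j). \<forall>x\<in>W. x $ i = x $ j}"

definition opposite :: "('a::ab_group_add ^ 'n) set \<Rightarrow> ('n \<times> 'n) set" where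
  "opposite W = {(i, j). \<forall>x\<in>W. x $ i = - x $ j}"

text \<open>The union names the partner class without choosing a representative: all
  \<open>i \<in> A\<close> have the same opposite indices.\<close>

definition opposite_class :: "('a::ab_group_add ^ 'n) set \<Rightarrow> 'n set \<Rightarrow> 'n set option" where
  "opposite_class W A =
     (if \<exists>i j. A = agree W `` {i} \<and> (i, j) \<in> opposite W
      then Some (\<Union>i\<in>A. opposite W `` {i}) else None)"

lemma equiv_agree: "equiv UNIV (agree W)"
  by (rule equivI) (auto simp: agree_def refl_on_def sym_def trans_def)

lemma class_of_agree: "class_of (UNIV // agree W) i = agree W `` {i}"
  unfolding class_of_def
proof (rule the_equality)
  show "agree W `` {i} \<in> UNIV // agree W \<and> i \<in> agree W `` {i}"
    by (auto simp: quotient_def agree_def)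
  show "A = agree W `` {i}" if "A \<in> UNIV // agree W \<and> i \<in> A" for A
    using that equiv_class_eq[OF equiv_agree] by (fastforce elim!: quotientE)
qed

lemma agree_class_eq_iff: "agree W `` {i} = agree W `` {j} \<longleftrightarrow> (i, j) \<in> agree W"
  by (simp add: eq_equiv_class_iff[OF equiv_agree])

lemma opposite_agree_trans:
  "(i, j) \<in> opposite W \<Longrightarrow> (i, i') \<in> agree W \<Longrightarrow> (j, j') \<in> agree W \<Longrightarrow> (i', j') \<in> opposite W"
  unfolding agree_def opposite_def by simp

lemma opposite_opposite: "(i, j) \<in> opposite W \<Longrightarrow> (i, k) \<in> opposite W \<Longrightarrow> (j, k) \<in> agree W"
  by (auto simp: agree_def opposite_def)

lemma agree_refl: "(i, i) \<in> agree W"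
  by (simp add: agree_def)

lemma agree_sym: "(i, j) \<in> agree W \<Longrightarrow> (j, i) \<in> agree W"
  by (simp add: agree_def)

text \<open>Two opposites of \<open>i\<close> agree with each other, so the opposites of
  \<open>i\<close> form exactly the class of any one of them.\<close>

lemma opposite_class_agree:
  "opposite_class W (agree W `` {i}) = Some (agree W `` {j}) \<longleftrightarrow> (i, j) \<in> opposite W"
proof -
  have op: "(\<Union>i'\<in>agree W `` {i}. opposite W `` {i'}) = agree W `` {k}"
    if "(i, k) \<in> opposite W" for k
    using that agree_refl opposite_agree_trans opposite_opposite by blast
  show ?thesis
  proof
    assume "opposite_class W (agree W `` {i}) = Some (agree W `` {j})"
    then obtain i' k where k: "agree W `` {i} = agree W `` {i'}" "(i', k) \<in> opposite W"
      and eq: "(\<Union>i'\<in>agree W `` {i}. opposite W `` {i'}) = agree W `` {j}"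
      by (auto simp: opposite_class_def split: if_splits)
    then have ik: "(i, k) \<in> opposite W"
      by (auto simp: agree_class_eq_iff intro: opposite_agree_trans agree_sym agree_refl)
    then have "(k, j) \<in> agree W" using op[OF ik] eq agree_class_eq_iff by metis
    then show "(i, j) \<in> opposite W" using ik by (blast intro: opposite_agree_trans agree_refl)
  qed (use op in \<open>auto simp: opposite_class_def\<close>)
qed

lemma opposite_class_SomeE:
  assumes "opposite_class W A = Some B"
  obtains i j where "A = agree W `` {i}" "B = agree W `` {j}" "(i, j) \<in> opposite W"
proof -
  obtain i j where "A = agree W `` {i}" "(i, j) \<in> opposite W"
    using assms by (auto simp: opposite_class_def split: if_splits)
  moreover from this have "B = agree W `` {j}"
    using assms opposite_class_agree[of W i j] by simp
  ultimately show ?thesis using that by blast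
qed

lemma opposite_sym: "(i, j) \<in> opposite W \<Longrightarrow> (j, i) \<in> opposite W"
  by (auto simp: opposite_def)

text \<open>The involution property is the symmetry of \<open>opposite\<close>. A class that is its
  own partner consists of coordinates that vanish on \<open>W\<close>, and all such coordinates
  agree, so there is at most one.\<close>

lemma tagged_partition_agree:
  fixes W :: "('a::real_vector ^ 'n) set"
  shows "tagged_partition_on UNIV (UNIV // agree W) (opposite_class W)"
  unfolding tagged_partition_on_def partial_involution_on_def
proof (intro conjI allI impI)
  show "partition_on UNIV (UNIV // agree W)"
    by (rule partition_on_quotient[OF equiv_agree])
  show "dom (opposite_class W) \<subseteq> UNIV // agree W"
    by (auto elim!: opposite_class_SomeE simp: quotient_def)
  show "opposite_class W B = Some A" if "opposite_class W A = Some B" for A B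
    using that by (auto elim!: opposite_class_SomeE simp: opposite_class_agree intro: opposite_sym)
  show "A = B" if A: "opposite_class W A = Some A" and B: "opposite_class W B = Some B" for A B
  proof -
    obtain i j where A': "A = agree W `` {i}" and B': "B = agree W `` {j}"
      using A B by (metis opposite_class_SomeE)
    have "(i, i) \<in> opposite W" "(j, j) \<in> opposite W"
      using A B unfolding A' B' opposite_class_agree by auto
    then have "\<forall>x\<in>W. x $ i = 0 \<and> x $ j = 0" by (simp add: opposite_def eq_uminus_self_iff)
    then show ?thesis by (simp add: A' B' agree_class_eq_iff) (simp add: agree_def)
  qed
qed simp

lemma mem_tensor_polydiagonal_agree:
  "y \<in> tensor_polydiagonal (UNIV // agree W) (opposite_class W) \<longleftrightarrow>
     (\<forall>(i, j)\<in>agree W. y $ i = y $ j) \<and> (\<forall>(i, j)\<in>opposite W. y $ i = - y $ j)"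
  by (auto simp: tensor_polydiagonal_def class_of_agree agree_class_eq_iff opposite_class_agree)

text \<open>Each pair outside \<open>agree W\<close> or \<open>opposite W\<close> gives a linear
  map, a difference or a sum of two coordinates, that is not identically 0 on \<open>W\<close>. A
  generic vector avoids all these kernels at once.\<close>

lemma ex_generic_vector:
  fixes W :: "('a::real_vector ^ 'n) set"
  assumes "subspace W"
  obtains x where "x \<in> W" "\<And>i j. x $ i = x $ j \<Longrightarrow> (i, j) \<in> agree W"
    "\<And>i j. x $ i = - x $ j \<Longrightarrow> (i, j) \<in> opposite W"
proof -
  define \<T> where "\<T> = (\<lambda>(i, j) x. x $ i - x $ j :: 'a) ` (- agree W)
     \<union> (\<lambda>(i, j) x. x $ i + x $ j) ` (- opposite W)"
  have "\<exists>x\<in>W. \<forall>T\<in>\<T>. T x \<noteq> 0"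
  proof (rule subspace_avoids_kernels)
    show "finite \<T>" by (simp add: \<T>_def)
    show "linear T \<and> (\<exists>w\<in>W. T w \<noteq> 0)" if "T \<in> \<T>" for T
      using that
      by (auto simp: \<T>_def agree_def opposite_def eq_neg_iff_add_eq_0 linear_iff algebra_simps)
  qed (rule assms)
  then obtain x where x: "x \<in> W" "\<forall>T\<in>\<T>. T x \<noteq> 0" by blast
  show ?thesis
  proof (rule that[OF x(1)]; rule ccontr)
    fix i j
    show False if "x $ i = x $ j" "(i, j) \<notin> agree W"
    proof -
      have "(\<lambda>x. x $ i - x $ j) \<in> \<T>" using that(2) by (force simp: \<T>_def)
      with x(2) that(1) show False by fastforce
    qed
    show False if "x $ i = - x $ j" "(i, j) \<notin> opposite W"
    proof -
      have "(\<lambda>x. x $ i + x $ j) \<in> \<T>" using that(2) by (force simp: \<T>_def)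
      with x(2) that(1) show False by fastforce
    qed
  qed
qed

lemma odd_interpolation:
  fixes x y :: "('a::euclidean_space) ^ 'n"
  assumes "\<And>i j. x $ i = x $ j \<Longrightarrow> y $ i = y $ j" "\<And>i j. x $ i = - x $ j \<Longrightarrow> y $ i = - y $ j"
  obtains f where "smooth f" "odd_fun f" "\<And>i. f (x $ i) = y $ i"
proof -
  \<comment> \<open>The assumptions make the prescription \<open>y $ i\<close> at
    \<open>x $ i\<close> and \<open>- y $ i\<close> at \<open>- x $ i\<close> consistent, whichever
    index is chosen and even where the two kinds of node coincide.\<close>
  define \<phi> where "\<phi> z = (if \<exists>i. z = x $ i then y $ (SOME i. z = x $ i) else - y $ (SOME i. z = - x $ i))" for z
  have \<phi>1: "\<phi> (x $ i) = y $ i" for i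
  proof -
    have "y $ (SOME j. x $ i = x $ j) = y $ i"
      by (rule someI2[of "\<lambda>j. x $ i = x $ j" i], rule refl, rule assms(1)[symmetric])
    then show ?thesis unfolding \<phi>_def by metis
  qed
  have \<phi>2: "\<phi> (- x $ i) = - y $ i" for i
  proof (cases "\<exists>j. - x $ i = x $ j")
    case True
    then obtain j where "- x $ i = x $ j" by blast
    then show ?thesis using \<phi>1 assms(2) by metis
  next
    case False
    have "y $ (SOME j. - x $ i = - x $ j) = y $ i"
      by (rule someI2[of "\<lambda>j. - x $ i = - x $ j" i], rule refl,
          rule assms(1)[symmetric], unfold neg_equal_iff_equal)
    then show ?thesis using False unfolding \<phi>_def by metis
  qed
  obtain p where p: "polynomial_function p"
    "\<And>z. z \<in> range (\<lambda>i. x $ i) \<union> range (\<lambda>i. - x $ i) \<Longrightarrow> p z = \<phi> z"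
    using polynomial_interpolation[of "range (\<lambda>i. x $ i) \<union> range (\<lambda>i. - x $ i)" \<phi>] by auto
  \<comment> \<open>The odd part of \<open>p\<close> keeps the interpolated values, as these are
    already odd on the symmetric set of nodes.\<close>
  define f where "f z = (1/2) *\<^sub>R (p z - p (- z))" for z
  have "polynomial_function (\<lambda>z. p (- z))"
    using polynomial_function_compose[OF polynomial_function_minus[OF polynomial_function_id] p(1)]
    by (simp add: o_def)
  then have "polynomial_function f"
    unfolding f_def by (intro polynomial_function_cmul polynomial_function_diff p(1))
  moreover have "odd_fun f" by (simp add: odd_fun_def f_def scaleR_diff_right)
  moreover have "f (x $ i) = y $ i" for i
    using p(2)[of "x $ i"] p(2)[of "- x $ i"] by (auto simp: f_def \<phi>1 \<phi>2 simp flip: scaleR_2)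
  ultimately show ?thesis using that smooth_polynomial_function by blast
qed

text \<open>A generic \<open>x\<close> in \<open>W\<close> has no accidental coincidences, so any
  \<open>y\<close> satisfying the relations of \<open>W\<close> is a pointwise image of
  \<open>x\<close> under an odd smooth map.\<close>

lemma eq_tensor_polydiagonal_agree:
  fixes W :: "(real^'k^'n) set"
  assumes "subspace W"
    and "\<And>f x. smooth f \<Longrightarrow> odd_fun f \<Longrightarrow> x \<in> W \<Longrightarrow> (\<chi> i. f (x $ i)) \<in> W"
  shows "W = tensor_polydiagonal (UNIV // agree W) (opposite_class W)"
proof
  show "W \<subseteq> tensor_polydiagonal (UNIV // agree W) (opposite_class W)"
    unfolding subset_iff mem_tensor_polydiagonal_agree by (auto simp: agree_def opposite_def)
  obtain x where x: "x \<in> W" "\<And>i j. x $ i = x $ j \<Longrightarrow> (i, j) \<in> agree W"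
    "\<And>i j. x $ i = - x $ j \<Longrightarrow> (i, j) \<in> opposite W"
    using ex_generic_vector[OF assms(1)] by blast
  show "tensor_polydiagonal (UNIV // agree W) (opposite_class W) \<subseteq> W"
  proof
    fix y :: "real^'k^'n" assume y: "y \<in> tensor_polydiagonal (UNIV // agree W) (opposite_class W)"
    have 1: "y $ i = y $ j" if "x $ i = x $ j" for i j
      using x(2)[OF that] y unfolding mem_tensor_polydiagonal_agree by blast
    have 2: "y $ i = - y $ j" if "x $ i = - x $ j" for i j
      using x(3)[OF that] y unfolding mem_tensor_polydiagonal_agree by blast
    obtain f where f: "smooth f" "odd_fun f" "\<And>i. f (x $ i) = y $ i"
      using odd_interpolation[of x y, OF 1 2] by blast
    have "y = (\<chi> i. f (x $ i))" by (simp add: f vec_eq_iff)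
    then show "y \<in> W" using assms(2)[OF f(1,2) x(1)] by simp
  qed
qed

lemma smooth_const: "smooth (\<lambda>_::'a::euclidean_space. c::'b::euclidean_space)"
  by (rule smooth_polynomial_function) simp

lemma network_field_diff:
  "network_field M H f x - network_field M H (\<lambda>_. 0) x = (\<chi> i. f (x $ i))"
  by (simp add: network_field_def vec_eq_iff)

subsection \<open>Invariance under families of functions\<close>

lemma pointwise_image_in:
  assumes "subspace W" "smooth f" "x \<in> W"
    and "dynamically_invariant (network_field M H f) W"
    and "dynamically_invariant (network_field M H (\<lambda>_. 0)) W"
  shows "(\<chi> i. f (x $ i)) \<in> W"
proof -
  have "network_field M H f x \<in> W" "network_field M H (\<lambda>_. 0) x \<in> W"
    using assms dynamically_invariant_network_iff smooth_const by blast+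
  then show ?thesis
    using subspace_diff[OF assms(1)] network_field_diff by metis
qed

text \<open>Common to the three converse directions, which differ only in why \<open>f\<close>
  changes sign along tagged pairs.\<close>

lemma dynamically_invariant_tensor_polydiagonal:
  fixes W :: "(real^'k^'n) set"
  assumes "W = tensor_polydiagonal P s" "matrix_invariant M (polydiagonal P s)" "subspace W" "smooth f"
    and "\<And>x i j. x \<in> W \<Longrightarrow> s (class_of P i) = Some (class_of P j) \<Longrightarrow> f (x $ i) = - f (x $ j)"
  shows "dynamically_invariant (network_field M H f) W"
  unfolding dynamically_invariant_network_iff[OF assms(3,4)]
  using network_field_in_tensor_polydiagonal[OF assms(2)] assms(1,5) by blast

text \<open>All three forward directions use this one tagged partition, since each hypothesis covers
  the odd functions. In particular \<open>f = 0\<close> is available.\<close>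

lemma odd_invariant_imp_polydiagonal:
  fixes W :: "(real^'k^'n) set"
  assumes "H \<noteq> 0" "subspace W"
    and inv: "\<And>f. smooth f \<Longrightarrow> odd_fun f \<Longrightarrow> dynamically_invariant (network_field M H f) W"
  shows "W = tensor_polydiagonal (UNIV // agree W) (opposite_class W)"
    and "matrix_invariant M (polydiagonal (UNIV // agree W) (opposite_class W))"
proof -
  have inv0: "dynamically_invariant (network_field M H (\<lambda>_. 0)) W"
    by (intro inv smooth_const) (simp add: odd_fun_def)
  show W: "W = tensor_polydiagonal (UNIV // agree W) (opposite_class W)"
    using eq_tensor_polydiagonal_agree[OF assms(2)] pointwise_image_in[OF assms(2)] inv inv0 by blast
  have "network_field M H (\<lambda>_. 0) x \<in> W" if "x \<in> W" for x
    using inv0 that dynamically_invariant_network_iff[OF assms(2) smooth_const] by blast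
  then show "matrix_invariant M (polydiagonal (UNIV // agree W) (opposite_class W))"
    using matrix_invariant_polydiagonal[OF assms(1)] W by metis
qed

lemma opposite_imp_zero:
  fixes W :: "(real^'k^'n) set"
  assumes "\<And>f x. smooth f \<Longrightarrow> f 0 = 0 \<Longrightarrow> x \<in> W \<Longrightarrow> (\<chi> i. f (x $ i)) \<in> W"
    and "(i, j) \<in> opposite W" "x \<in> W"
  shows "x $ i = 0"
proof (rule ccontr)
  assume nz: "x $ i \<noteq> 0"
  have xj: "x $ i = - x $ j" using assms(2,3) by (simp add: opposite_def)
  \<comment> \<open>If \<open>x $ i\<close> were nonzero, it would differ from \<open>x $ j\<close>
    and from 0, so some \<open>p\<close> fixing 0 could keep \<open>x $ i\<close> and send
    \<open>x $ j\<close> to 0. The image would violate the relation.\<close>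
  obtain p where p: "polynomial_function p"
    "\<And>z. z \<in> {x $ i, x $ j, 0} \<Longrightarrow> p z = (if z = x $ i then x $ i else 0)"
    using polynomial_interpolation[of "{x $ i, x $ j, 0}" "\<lambda>z. if z = x $ i then x $ i else 0"] by auto
  have ne: "x $ j \<noteq> x $ i"
    using xj nz by (metis eq_uminus_self_iff)
  have "p 0 = 0" "p (x $ i) = x $ i" "p (x $ j) = 0"
    using p(2)[of 0] p(2)[of "x $ i"] p(2)[of "x $ j"] nz ne by auto
  then have "(\<chi> i. p (x $ i)) \<in> W"
    using assms(1) smooth_polynomial_function[OF p(1)] assms(3) by blast
  then have "(\<chi> i. p (x $ i)) $ i = - (\<chi> i. p (x $ i)) $ j"
    using assms(2) unfolding opposite_def by blast
  then show False using \<open>p (x $ i) = x $ i\<close> \<open>p (x $ j) = 0\<close> nz by simp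
qed

text \<open>Coordinates in a tagged class vanish on \<open>W\<close>, and so do those in its
  partner, hence the two classes coincide. As there is at most one fixed point, the domain has at
  most one element.\<close>

lemma opposite_class_synchrony_or_minimally_tagged:
  fixes W :: "(real^'k^'n) set"
  assumes "\<And>f x. smooth f \<Longrightarrow> f 0 = 0 \<Longrightarrow> x \<in> W \<Longrightarrow> (\<chi> i. f (x $ i)) \<in> W"
  shows "synchrony (opposite_class W) \<or>
    minimally_tagged (opposite_class W) \<and> anti_synchrony (opposite_class W)"
proof -
  have fixpoint: "A = B" if AB: "opposite_class W A = Some B" for A B
  proof -
    obtain i j where ij: "A = agree W `` {i}" "B = agree W `` {j}" "(i, j) \<in> opposite W"
      using opposite_class_SomeE[OF AB] .
    have "x $ i = 0 \<and> x $ j = 0" if "x \<in> W" for x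
      using opposite_imp_zero[OF assms ij(3) that] opposite_imp_zero[OF assms opposite_sym[OF ij(3)] that]
      by blast
    then have "(i, j) \<in> agree W" by (simp add: agree_def)
    then show ?thesis by (simp add: ij agree_class_eq_iff)
  qed
  have unique: "A = B" if "opposite_class W A = Some A" "opposite_class W B = Some B" for A B
    using tagged_partition_agree[of W] that unfolding tagged_partition_on_def by blast
  show ?thesis
  proof (cases "opposite_class W = Map.empty")
    case True
    then show ?thesis by (simp add: synchrony_def)
  next
    case False
    then obtain A where A: "A \<in> dom (opposite_class W)" by auto
    have "dom (opposite_class W) = {A}"
      using A fixpoint unique by (auto simp: dom_def) (metis)+
    then show ?thesis using False by (simp add: minimally_tagged_def anti_synchrony_def)
  qed
qed

text \<open>An involution maps its domain to itself, and here the domain is a single class.\<close>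

lemma minimally_tagged_fixpoint:
  assumes "tagged_partition_on C P s" "minimally_tagged s" "s A = Some B"
  shows "A = B"
proof -
  have "s B = Some A"
    using assms(1,3) unfolding tagged_partition_on_def partial_involution_on_def by blast
  then have "A \<in> dom s" "B \<in> dom s" using assms(3) by auto
  then show ?thesis using assms(2) by (auto simp: minimally_tagged_def is_singleton_def)
qed

theorem proposition4p1:
  fixes M :: "real^'n^'n" and H :: "real^'k^'k" and W :: "(real^'k^'n) set"
  assumes "H \<noteq> 0" and "subspace W"
  shows
    "((\<forall>f. smooth f \<and> odd_fun f \<longrightarrow> dynamically_invariant (network_field M H f) W) \<longleftrightarrow>
        (\<exists>P s. tagged_partition_on UNIV P s \<and> matrix_invariant M (polydiagonal P s) \<and>
           W = tensor_polydiagonal P s)) \<and>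
     ((\<forall>f. smooth f \<and> f 0 = 0 \<longrightarrow> dynamically_invariant (network_field M H f) W) \<longleftrightarrow>
        (\<exists>P s. tagged_partition_on UNIV P s \<and> matrix_invariant M (polydiagonal P s) \<and>
           (synchrony s \<or> (minimally_tagged s \<and> anti_synchrony s)) \<and>
           W = tensor_polydiagonal P s)) \<and>
     ((\<forall>f. smooth f \<longrightarrow> dynamically_invariant (network_field M H f) W) \<longleftrightarrow>
        (\<exists>P s. tagged_partition_on UNIV P s \<and> matrix_invariant M (polydiagonal P s) \<and>
           synchrony s \<and> W = tensor_polydiagonal P s))"
    (is "(?odd \<longleftrightarrow> ?polydiagonal) \<and> (?zero \<longleftrightarrow> ?minimal) \<and> (?all \<longleftrightarrow> ?synchrony)")
proof (intro conjI iffI)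
  have odd_zero: "f 0 = 0" if "odd_fun f" for f :: "real^'k \<Rightarrow> real^'k"
    using that unfolding odd_fun_def by (metis eq_uminus_self_iff minus_zero)
  note polydiagonal = odd_invariant_imp_polydiagonal[OF assms] tagged_partition_agree[of W]
  show ?polydiagonal if lhs: ?odd
    using polydiagonal lhs by blast
  show ?minimal if lhs: ?zero
  proof -
    have "(\<chi> i. f (x $ i)) \<in> W" if "smooth f" "f 0 = 0" "x \<in> W" for f x
      using pointwise_image_in[OF assms(2) that(1,3)] lhs that(1,2) smooth_const by blast
    then have "synchrony (opposite_class W) \<or>
        minimally_tagged (opposite_class W) \<and> anti_synchrony (opposite_class W)"
      by (rule opposite_class_synchrony_or_minimally_tagged)
    moreover have "dynamically_invariant (network_field M H f) W" if "smooth f" "odd_fun f" for f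
      using lhs that odd_zero by blast
    ultimately show ?thesis using polydiagonal by blast
  qed
  show ?synchrony if lhs: ?all
  proof -
    define c :: "real^'k" where "c = (\<chi> _. 1)"
    have c: "c \<noteq> - c" by (simp add: c_def vec_eq_iff)
    \<comment> \<open>The constant map with value \<open>c\<close> is applied to the zero vector of
      \<open>W\<close>. As \<open>c\<close> differs from its negative, the image rules out every
      opposite pair, including a coordinate opposite to itself.\<close>
    have "(\<chi> i. c) \<in> W"
      using pointwise_image_in[OF assms(2) smooth_const subspace_0[OF assms(2)]] lhs smooth_const
      by blast
    then have "opposite W = {}"
      using c by (force simp: opposite_def)
    then have "synchrony (opposite_class W)"
      by (simp add: synchrony_def opposite_class_def fun_eq_iff)
    then show ?thesis using polydiagonal lhs by blast
  qed
  show ?odd if rhs: ?polydiagonal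
  proof (intro allI impI)
    fix f :: "real^'k \<Rightarrow> real^'k" assume f: "smooth f \<and> odd_fun f"
    obtain P s where P: "matrix_invariant M (polydiagonal P s)" "W = tensor_polydiagonal P s"
      using rhs by blast
    have "f (x $ i) = - f (x $ j)"
      if x: "x \<in> W" "s (class_of P i) = Some (class_of P j)" for x i j
    proof -
      have "x $ i = - x $ j" using x unfolding P(2) tensor_polydiagonal_def by blast
      then show ?thesis using f by (metis odd_fun_def)
    qed
    then show "dynamically_invariant (network_field M H f) W"
      using dynamically_invariant_tensor_polydiagonal[OF P(2,1) assms(2)] f by blast
  qed
  show ?zero if rhs: ?minimal
  proof (intro allI impI)
    fix f :: "real^'k \<Rightarrow> real^'k" assume f: "smooth f \<and> f 0 = 0"
    obtain P s where P: "matrix_invariant M (polydiagonal P s)" "W = tensor_polydiagonal P s"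
      "tagged_partition_on UNIV P s" "synchrony s \<or> minimally_tagged s"
      using rhs by blast
    have "f (x $ i) = - f (x $ j)"
      if x: "x \<in> W" "s (class_of P i) = Some (class_of P j)" for x i j
    proof -
      \<comment> \<open>A tagged pair excludes the empty involution. The only tagged class is its
        own partner, so its coordinates are 0, where \<open>f\<close> vanishes.\<close>
      have "minimally_tagged s" using P(4) x(2) by (auto simp: synchrony_def)
      then have "class_of P i = class_of P j" using minimally_tagged_fixpoint P(3) x(2) by blast
      then have eq: "x $ i = x $ j" "x $ i = - x $ j"
        using x unfolding P(2) tensor_polydiagonal_def by blast+
      then have "x $ j = 0" by (metis eq_uminus_self_iff)
      then show ?thesis using f eq(1) by simp
    qed
    then show "dynamically_invariant (network_field M H f) W"
      using dynamically_invariant_tensor_polydiagonal[OF P(2,1) assms(2)] f by blast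
  qed
  show ?all if rhs: ?synchrony
  proof (intro allI impI)
    fix f :: "real^'k \<Rightarrow> real^'k" assume f: "smooth f"
    obtain P s where P: "matrix_invariant M (polydiagonal P s)" "W = tensor_polydiagonal P s"
      "synchrony s"
      using rhs by blast
    show "dynamically_invariant (network_field M H f) W"
      \<comment> \<open>With an empty involution there are no tagged pairs, so the sign condition on
        \<open>f\<close> is vacuous.\<close>
      by (rule dynamically_invariant_tensor_polydiagonal[OF P(2,1) assms(2) f])
        (use P(3) in \<open>simp add: synchrony_def\<close>)
  qed
qed

end
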